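(* Let $\mathcal{F}$ be a (possibly infinite) signature with only finitely many AC symbols, and let $>$ be a well-founded precedence on $\mathcal{F}$ in which all AC symbols are minimal. Then $>_{\mathrm{acmpo}}$ is an AC-compatible reduction order.
   Context: $\mathcal{F}$ is a signature of function symbols with arities, $\mathcal{V}$ a countably infinite set of variables, and $\mathcal{F}_{\mathrm{AC}}\subseteq\mathcal{F}$ the set of AC symbols (binary); $=_{\mathrm{AC}}$ is the congruence generated by $f(f(x,y),z)\approx f(x,f(y,z))$ and $f(x,y)\approx f(y,x)$ for $f\in\mathcal{F}_{\mathrm{AC}}$. $\mathrm{root}(t)$ is $t$ if $t$ is a variable and $f$ if $t=f(t_1,\dots,t_n)$. For non-variable $t=f(t_1,\dots,t_n)$, $\mathrm{TF}(t)=\mathrm{TF}_f(t_1)\uplus\cdots\uplus\mathrm{TF}_f(t_n)$, where $\mathrm{TF}_f(u)=\mathrm{TF}_f(u_1)\uplus\mathrm{TF}_f(u_2)$ if $u=f(u_1,u_2)$ with $f\in\mathcal{F}_{\mathrm{AC}}$, and $\mathrm{TF}_f(u)=\{u\}$ otherwise. $=_{\mathrm{AC}}^{\mathrm{mul}}$: $\varnothing=_{\mathrm{AC}}^{\mathrm{mul}}\varnothing$, and $\{s\}\uplus M=_{\mathrm{AC}}^{\mathrm{mul}}\{t\}\uplus N$ if $s=_{\mathrm{AC}}t$ and $M=_{\mathrm{AC}}^{\mathrm{mul}}N$. A precedence is a strict order $>$ on $\mathcal{F}$; an AC symbol $f$ is minimal if there is no $g$ with $f>g$. $s>_{\mathrm{acmpo}}t$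 iff $s\notin\mathcal{V}$ and one of: (1) some $s'\in\mathrm{TF}(s)$ has $s'>_{\mathrm{acmpo}}t$ or $s'=_{\mathrm{AC}}t$; (2) $\mathrm{root}(s)>\mathrm{root}(t)$ and $s>_{\mathrm{acmpo}}t'$ for all $t'\in\mathrm{TF}(t)$; (3) $\mathrm{root}(s)=\mathrm{root}(t)$ and there are multisets with $\mathrm{TF}(s)=S_1\uplus S_2$, $\mathrm{TF}(t)=T_1\uplus T_2$, $S_1=_{\mathrm{AC}}^{\mathrm{mul}}T_1$, $S_2\ne\varnothing$, and each $t'\in T_2$ has some $s'\in S_2$ with $s'>_{\mathrm{acmpo}}t'$. A reduction order is a well-founded strict order on terms closed under contexts and substitutions; it is AC-compatible if ${=_{\mathrm{AC}}}\cdot{>}\cdot{=_{\mathrm{AC}}}\subseteq{>}$. *)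

theory Defs
  imports "HOL-Library.Multiset" "HOL-Library.Countable_Set"
begin

datatype ('f, 'v) trm = Var 'v | Fun 'f "('f, 'v) trm list"

text \<open>
  A signature is a set \<open>F\<close> of function symbols with an arity function \<open>ar\<close>. The set of terms over
  \<open>F\<close> and the variables \<open>V\<close> is \<open>terms F ar V\<close>. The type \<open>trm\<close> itself does not enforce arities, so
  all properties of relations on terms are stated relative to this set.
\<close>

inductive_set terms :: "'f set \<Rightarrow> ('f \<Rightarrow> nat) \<Rightarrow> 'v set \<Rightarrow> ('f, 'v) trm set"
  for F :: "'f set" and ar :: "'f \<Rightarrow> nat" and V :: "'v set"
where
  Var: "x \<in> V \<Longrightarrow> Var x \<in> terms F ar V"
| Fun: "f \<in> F \<Longrightarrow> length ts = ar f \<Longrightarrow> (\<And>t. t \<in> set ts \<Longrightarrow> t \<in> terms F ar V) \<Longrightarrow>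
    Fun f ts \<in> terms F ar V"

primrec subst :: "('v \<Rightarrow> ('f, 'v) trm) \<Rightarrow> ('f, 'v) trm \<Rightarrow> ('f, 'v) trm" where
  "subst \<sigma> (Var x) = \<sigma> x"
| "subst \<sigma> (Fun f ts) = Fun f (map (subst \<sigma>) ts)"

datatype ('f, 'v) ctxt = Hole | More 'f "('f, 'v) trm list" "('f, 'v) ctxt" "('f, 'v) trm list"

primrec fill :: "('f, 'v) ctxt \<Rightarrow> ('f, 'v) trm \<Rightarrow> ('f, 'v) trm" where
  "fill Hole t = t"
| "fill (More f us C vs) t = Fun f (us @ fill C t # vs)"

inductive_set ctxts :: "'f set \<Rightarrow> ('f \<Rightarrow> nat) \<Rightarrow> 'v set \<Rightarrow> ('f, 'v) ctxt set"
  for F :: "'f set" and ar :: "'f \<Rightarrow> nat" and V :: "'v set"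
where
  Hole: "Hole \<in> ctxts F ar V"
| More: "f \<in> F \<Longrightarrow> Suc (length us + length vs) = ar f \<Longrightarrow>
    set us \<subseteq> terms F ar V \<Longrightarrow> set vs \<subseteq> terms F ar V \<Longrightarrow> C \<in> ctxts F ar V \<Longrightarrow>
    More f us C vs \<in> ctxts F ar V"

text \<open>
  The parameter \<open>A\<close> below is the set of AC symbols. Since the AC axioms and the congruence rule
  relate a term of \<open>terms F ar V\<close> only to terms of this set (AC symbols being binary symbols of
  \<open>F\<close>), the restriction of \<open>ac_eq A\<close> to \<open>terms F ar V\<close> is the congruence generated on that set.
\<close>

inductive ac_eq :: "'f set \<Rightarrow> ('f, 'v) trm \<Rightarrow> ('f, 'v) trm \<Rightarrow> bool"
  for A :: "'f set"
where
  assoc: "f \<in> A \<Longrightarrow> ac_eq A (Fun f [Fun f [s, t], u]) (Fun f [s, Fun f [t, u]])"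
| comm: "f \<in> A \<Longrightarrow> ac_eq A (Fun f [s, t]) (Fun f [t, s])"
| refl: "ac_eq A t t"
| sym: "ac_eq A s t \<Longrightarrow> ac_eq A t s"
| trans: "ac_eq A s t \<Longrightarrow> ac_eq A t u \<Longrightarrow> ac_eq A s u"
| cong: "list_all2 (ac_eq A) ss ts \<Longrightarrow> ac_eq A (Fun f ss) (Fun f ts)"

primrec root :: "('f, 'v) trm \<Rightarrow> 'v + 'f" where
  "root (Var x) = Inl x"
| "root (Fun f ts) = Inr f"

fun TF_sym :: "'f set \<Rightarrow> 'f \<Rightarrow> ('f, 'v) trm \<Rightarrow> ('f, 'v) trm multiset" where
  "TF_sym A f (Fun g [u, v]) =
     (if g = f \<and> f \<in> A then TF_sym A f u + TF_sym A f v else {#Fun g [u, v]#})"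
| "TF_sym A f u = {#u#}"

text \<open>
  \<open>TF\<close> is meaningful for non-variable terms only; its value on variables is a dummy that the order
  below never uses.
\<close>

primrec TF :: "'f set \<Rightarrow> ('f, 'v) trm \<Rightarrow> ('f, 'v) trm multiset" where
  "TF A (Var x) = {#}"
| "TF A (Fun f ts) = (\<Sum>t\<leftarrow>ts. TF_sym A f t)"

text \<open>
  The recursion in the definition of the order decreases the total size of the two terms compared,
  so it has exactly one solution, which is the least fixed point taken here. The library predicate
  \<open>rel_mset'\<close> is the inductively defined extension of a relation to multisets.
\<close>

inductive acmpo :: "'f set \<Rightarrow> ('f \<Rightarrow> 'f \<Rightarrow> bool) \<Rightarrow> ('f, 'v) trm \<Rightarrow> ('f, 'v) trm \<Rightarrow> bool"
  for A :: "'f set" and prec :: "'f \<Rightarrow> 'f \<Rightarrow> bool"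
where
  sub: "root s = Inr f \<Longrightarrow> s' \<in># TF A s \<Longrightarrow> acmpo A prec s' t \<or> ac_eq A s' t \<Longrightarrow>
    acmpo A prec s t"
| prec: "root s = Inr f \<Longrightarrow> root t = Inr g \<Longrightarrow> prec f g \<Longrightarrow>
    (\<forall>t' \<in># TF A t. acmpo A prec s t') \<Longrightarrow>
    acmpo A prec s t"
| mul: "root s = Inr f \<Longrightarrow> root t = Inr f \<Longrightarrow>
    TF A s = S1 + S2 \<Longrightarrow> TF A t = T1 + T2 \<Longrightarrow> rel_mset' (ac_eq A) S1 T1 \<Longrightarrow> S2 \<noteq> {#} \<Longrightarrow>
    (\<forall>t' \<in># T2. \<exists>s' \<in># S2. acmpo A prec s' t') \<Longrightarrow>
    acmpo A prec s t"

text \<open>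
  In the next three definitions \<open>gt s t\<close> reads ``\<open>s\<close> is greater than \<open>t\<close>''; hence well-foundedness,
  i.e. the absence of infinite descending sequences, is \<open>wfp_on\<close> of the converse relation.
\<close>

definition reduction_order ::
  "'f set \<Rightarrow> ('f \<Rightarrow> nat) \<Rightarrow> 'v set \<Rightarrow> (('f, 'v) trm \<Rightarrow> ('f, 'v) trm \<Rightarrow> bool) \<Rightarrow> bool"
where
  "reduction_order F ar V gt \<longleftrightarrow>
     irreflp_on (terms F ar V) gt \<and>
     transp_on (terms F ar V) gt \<and>
     wfp_on (terms F ar V) gt\<inverse>\<inverse> \<and>
     (\<forall>s \<in> terms F ar V. \<forall>t \<in> terms F ar V. \<forall>C \<in> ctxts F ar V.
        gt s t \<longrightarrow> gt (fill C s) (fill C t)) \<and>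
     (\<forall>s \<in> terms F ar V. \<forall>t \<in> terms F ar V. \<forall>\<sigma>. (\<forall>x \<in> V. \<sigma> x \<in> terms F ar V) \<longrightarrow>
        gt s t \<longrightarrow> gt (subst \<sigma> s) (subst \<sigma> t))"

definition ac_compatible ::
  "'f set \<Rightarrow> ('f \<Rightarrow> nat) \<Rightarrow> 'v set \<Rightarrow> 'f set \<Rightarrow>
    (('f, 'v) trm \<Rightarrow> ('f, 'v) trm \<Rightarrow> bool) \<Rightarrow> bool"
where
  "ac_compatible F ar V A gt \<longleftrightarrow>
     (\<forall>s \<in> terms F ar V. \<forall>s' \<in> terms F ar V. \<forall>t' \<in> terms F ar V. \<forall>t \<in> terms F ar V.
        ac_eq A s s' \<longrightarrow> gt s' t' \<longrightarrow> ac_eq A t' t \<longrightarrow> gt s t)"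

definition wf_precedence :: "'f set \<Rightarrow> ('f \<Rightarrow> 'f \<Rightarrow> bool) \<Rightarrow> bool" where
  "wf_precedence F gt \<longleftrightarrow> irreflp_on F gt \<and> transp_on F gt \<and> wfp_on F gt\<inverse>\<inverse>"

end

theory Submission
  imports Defs
begin

text \<open>
  Multisets are compared modulo AC by mapping a choice of class representatives over them, so that
  the third clause of the order becomes an ordinary multiset comparison. Minimality of the AC symbols
  gives closure under contexts: if \<open>s > t\<close> and the AC symbol \<open>f\<close> is the root of \<open>s\<close> but not of \<open>t\<close>, the
  second clause is impossible, so some element of \<open>TF s\<close> already dominates \<open>t\<close>. For well-foundedness,
  call a term accessible if all descending sequences from it are finite. A term whose top-flattening
  consists of accessible terms is accessible, by induction on its root, then on the multiset of
  classes of its top-flattening, and for each smaller term on the size of that term.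
\<close>

section \<open>Multiset extension modulo a kernel\<close>

text \<open>The kernel of \<open>c\<close> is the equivalence modulo which common parts are
  cancelled; \<open>c\<close> will be a choice of class representatives. For injective
  \<open>c\<close> and transitive \<open>R\<close> this is the Dershowitz-Manna extension.\<close>

definition ms_ext :: "('a \<Rightarrow> 'b) \<Rightarrow> ('a \<Rightarrow> 'a \<Rightarrow> bool) \<Rightarrow> 'a multiset \<Rightarrow> 'a multiset \<Rightarrow> bool" where
  "ms_ext c R S T \<longleftrightarrow> (\<exists>S1 S2 T1 T2. S = S1 + S2 \<and> T = T1 + T2 \<and>
     image_mset c S1 = image_mset c T1 \<and> S2 \<noteq> {#} \<and> (\<forall>t \<in># T2. \<exists>s \<in># S2. R s t))"

lemma ms_extI:
  assumes "S = S1 + S2" "T = T1 + T2" "image_mset c S1 = image_mset c T1" "S2 \<noteq> {#}"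
    and "\<And>t. t \<in># T2 \<Longrightarrow> \<exists>s \<in># S2. R s t"
  shows "ms_ext c R S T"
  unfolding ms_ext_def using assms by blast

lemma ms_extE:
  assumes "ms_ext c R S T"
  obtains S1 S2 T1 T2 where "S = S1 + S2" "T = T1 + T2" "image_mset c S1 = image_mset c T1"
    "S2 \<noteq> {#}" "\<And>t. t \<in># T2 \<Longrightarrow> \<exists>s \<in># S2. R s t"
  using assms unfolding ms_ext_def by blast

lemma image_mset_eq_memD:
  assumes "image_mset c S = image_mset c T" "t \<in># T"
  obtains s where "s \<in># S" "c s = c t"
  using assms by (metis image_iff set_image_mset)

lemma ms_ext_plus:
  assumes "ms_ext c R S T"
  shows "ms_ext c R (X + S) (X + T)"
proof -
  obtain S1 S2 T1 T2 where *: "S = S1 + S2" "T = T1 + T2" "image_mset c S1 = image_mset c T1"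
    "S2 \<noteq> {#}" "\<And>t. t \<in># T2 \<Longrightarrow> \<exists>s \<in># S2. R s t"
    using assms by (rule ms_extE) (blast intro: that)
  show ?thesis
    by (rule ms_extI[of _ "X + S1" S2 _ "X + T1" T2]) (use * in \<open>simp_all add: add.assoc\<close>)
qed

text \<open>The two splittings of \<open>T\<close> have a common refinement into four blocks:
  \<open>A\<close> is matched in both comparisons, \<open>B\<close> only in the first,
  \<open>C\<close> only in the second, \<open>D\<close> in neither. Transitivity of \<open>R\<close>
  is assumed only for elements of the three multisets, so that an induction on term size can supply
  it.\<close>

lemma ms_ext_trans:
  assumes "ms_ext c R S T" "ms_ext c R T U"
    and left: "\<And>s t u. c s = c t \<Longrightarrow> R t u \<Longrightarrow> R s u"
    and right: "\<And>s t u. R s t \<Longrightarrow> c t = c u \<Longrightarrow> R s u"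
    and trans: "\<And>s t u. s \<in># S \<Longrightarrow> t \<in># T \<Longrightarrow> u \<in># U \<Longrightarrow> R s t \<Longrightarrow> R t u \<Longrightarrow> R s u"
  shows "ms_ext c R S U"
proof -
  obtain S1 S2 T1 T2 where S: "S = S1 + S2" and T: "T = T1 + T2"
    and eq1: "image_mset c S1 = image_mset c T1" and ne: "S2 \<noteq> {#}"
    and dom1: "\<And>t. t \<in># T2 \<Longrightarrow> \<exists>s \<in># S2. R s t"
    using assms(1) by (rule ms_extE) (blast intro: that)
  obtain T1' T2' U1 U2 where T': "T = T1' + T2'" and U: "U = U1 + U2"
    and eq2: "image_mset c T1' = image_mset c U1"
    and dom2: "\<And>u. u \<in># U2 \<Longrightarrow> \<exists>t \<in># T2'. R t u"
    using assms(2) by (rule ms_extE) (blast intro: that)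
  define A B C D where "A = T1 \<inter># T1'" and "B = T1 - T1'" and "C = T1' - T1" and "D = T2 - C"
  have T1: "T1 = A + B" and T1': "T1' = A + C"
    unfolding A_def B_def C_def by (rule multiset_eqI; simp)+
  have TT: "T1 + T2 = T1' + T2'" using T T' by simp
  \<comment> \<open>Equality of the two sums gives \<open>C \<subseteq># T2\<close> and
    \<open>B \<subseteq># T2'\<close>, so truncated subtraction loses no elements.\<close>
  have cnt: "count T1 x + count T2 x = count T1' x + count T2' x" for x
    using arg_cong[OF TT, of "\<lambda>M. count M x"] by simp
  have T2: "T2 = C + D"
  proof (rule multiset_eqI)
    show "count T2 x = count (C + D) x" for x
      using cnt[of x] by (simp add: C_def D_def)
  qed
  have T2': "T2' = B + D"
  proof (rule multiset_eqI)
    show "count T2' x = count (B + D) x" for x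
      using cnt[of x] by (simp add: B_def C_def D_def)
  qed
  from eq1 T1 have "image_mset c S1 = image_mset c A + image_mset c B" by simp
  then obtain SA SB where S1: "S1 = SA + SB" and SA: "image_mset c SA = image_mset c A"
    and SB: "image_mset c SB = image_mset c B"
    by (metis image_mset_eq_plusD)
  from eq2 T1' have "image_mset c U1 = image_mset c A + image_mset c C" by simp
  then obtain UA UC where U1: "U1 = UA + UC" and UA: "image_mset c UA = image_mset c A"
    and UC: "image_mset c UC = image_mset c C"
    by (metis image_mset_eq_plusD)
  show ?thesis
  proof (rule ms_extI[of _ SA "SB + S2" _ UA "UC + U2"])
    fix u assume "u \<in># UC + U2"
    then consider "u \<in># UC" | "u \<in># U2" by auto
    then show "\<exists>s \<in># SB + S2. R s u"
    proof cases
      case 1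
      then obtain t where t: "t \<in># C" "c t = c u" using UC by (metis image_mset_eq_memD)
      then obtain s where "s \<in># S2" "R s t" using dom1 T2 by auto
      then show ?thesis using right t by auto
    next
      case 2
      then obtain t where t: "t \<in># T2'" "R t u" using dom2 by blast
      then consider "t \<in># B" | "t \<in># D" using T2' by auto
      then show ?thesis
      proof cases
        case 1
        then obtain s where "s \<in># SB" "c s = c t" using SB by (metis image_mset_eq_memD)
        then show ?thesis using left t by auto
      next
        case d: 2
        then obtain s where s: "s \<in># S2" "R s t" using dom1 T2 by auto
        have "R s u"
          by (rule trans[of s t u]) (use s t 2 S T' U in auto)
        then show ?thesis using s by auto
      qed
    qed
  qed (use S S1 U U1 SA UA ne in \<open>auto simp: add.assoc\<close>)
qed

section \<open>AC equivalence and top-flattening\<close>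

text \<open>The choice depends only on the predicate \<open>ac_eq A s\<close>, which is the same for
  all members of a class, so each class gets a single representative.\<close>

definition ac_rep :: "'f set \<Rightarrow> ('f, 'v) trm \<Rightarrow> ('f, 'v) trm" where
  "ac_rep A s = (SOME t. ac_eq A s t)"

lemma ac_eq_rep: "ac_eq A s (ac_rep A s)"
  unfolding ac_rep_def by (rule someI[of _ s]) (rule ac_eq.refl)

lemma ac_eq_iff_rep: "ac_eq A s t \<longleftrightarrow> ac_rep A s = ac_rep A t"
proof
  assume "ac_eq A s t"
  then have "ac_eq A s = ac_eq A t"
    by (intro ext) (meson ac_eq.sym ac_eq.trans)
  then show "ac_rep A s = ac_rep A t" by (simp add: ac_rep_def)
next
  assume "ac_rep A s = ac_rep A t"
  then show "ac_eq A s t" by (metis ac_eq_rep ac_eq.sym ac_eq.trans)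
qed

text \<open>Since \<open>ac_eq A\<close> is the kernel of \<open>ac_rep A\<close>, relating
  multisets by it amounts to equality of their images.\<close>

lemma rel_mset'_ac_eq_iff:
  "rel_mset' (ac_eq A) S T \<longleftrightarrow> image_mset (ac_rep A) S = image_mset (ac_rep A) T"
proof -
  have "rel_mset' (ac_eq A) S T \<longleftrightarrow> rel_mset (ac_eq A) S T"
    using rel_mset'_imp_rel_mset rel_mset_imp_rel_mset' by blast
  also have "\<dots> \<longleftrightarrow> rel_mset (\<lambda>x y. ac_rep A x = ac_rep A y) S T"
    by (simp add: ac_eq_iff_rep[abs_def])
  also have "\<dots> \<longleftrightarrow> image_mset (ac_rep A) S = image_mset (ac_rep A) T"
    by (simp add: multiset.rel_map flip: multiset.rel_eq)
  finally show ?thesis .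
qed

lemma TF_sym_Fun:
  "TF_sym A f (Fun g ts) =
     (if g = f \<and> f \<in> A \<and> length ts = 2 then TF A (Fun g ts) else {#Fun g ts#})"
  by (cases "(A, f, Fun g ts)" rule: TF_sym.cases) auto

lemma ac_eq_root: "ac_eq A s t \<Longrightarrow> root s = root t"
  by (induction rule: ac_eq.induct) auto

text \<open>Both claims are proved together: under a congruence step, flattening the arguments gives
  the claim for \<open>TF\<close>, and \<open>TF_sym_Fun\<close> reduces the claim for
  \<open>TF_sym\<close> to it or to singletons.\<close>

lemma ac_eq_TF_TF_sym:
  "ac_eq A s t \<Longrightarrow> image_mset (ac_rep A) (TF A s) = image_mset (ac_rep A) (TF A t) \<and>
     (\<forall>f. image_mset (ac_rep A) (TF_sym A f s) = image_mset (ac_rep A) (TF_sym A f t))"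
proof (induction rule: ac_eq.induct)
  case (assoc f s t u)
  have "ac_rep A (Fun f [Fun f [s, t], u]) = ac_rep A (Fun f [s, Fun f [t, u]])"
    using ac_eq.assoc[OF assoc] by (simp add: ac_eq_iff_rep)
  then show ?case using assoc by (auto simp: ac_simps)
next
  case (comm f s t)
  have "ac_rep A (Fun f [s, t]) = ac_rep A (Fun f [t, s])"
    using ac_eq.comm[OF comm] by (simp add: ac_eq_iff_rep)
  then show ?case using comm by (auto simp: ac_simps)
next
  case (cong ss ts f)
  have "image_mset (ac_rep A) (\<Sum>t\<leftarrow>ss. TF_sym A f t) = image_mset (ac_rep A) (\<Sum>t\<leftarrow>ts. TF_sym A f t)"
    using cong.IH by (induction rule: list_all2_induct) auto
  moreover have "ac_rep A (Fun f ss) = ac_rep A (Fun f ts)"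
  proof -
    have "list_all2 (ac_eq A) ss ts" by (rule list_all2_mono[OF cong.IH]) blast
    then show ?thesis using ac_eq.cong by (simp add: ac_eq_iff_rep)
  qed
  \<comment> \<open>The test for two arguments in \<open>TF_sym_Fun\<close> must have the same
    outcome on both sides.\<close>
  moreover have "length ss = length ts" using cong.IH by (rule list_all2_lengthD)
  ultimately show ?case by (auto simp: TF_sym_Fun)
qed auto

lemmas ac_eq_TF = ac_eq_TF_TF_sym[THEN conjunct1]
lemmas ac_eq_TF_sym = ac_eq_TF_TF_sym[THEN conjunct2, rule_format]

lemma TF_sym_neq_empty: "TF_sym A f s \<noteq> {#}"
  by (induction A f s rule: TF_sym.induct) auto

lemma mem_sum_list_mset: "x \<in># (\<Sum>t\<leftarrow>ts. h t) \<longleftrightarrow> (\<exists>t \<in> set ts. x \<in># h t)"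
  by (induction ts) auto

lemma TF_sym_size: "u \<in># TF_sym A f s \<Longrightarrow> size u \<le> size s"
  by (induction A f s rule: TF_sym.induct) (auto split: if_splits)

text \<open>Elements are bounded in size by a proper argument of the term, so the decrease is
  strict; the inductions on term size below rest on it.\<close>

lemma TF_size: "u \<in># TF A s \<Longrightarrow> size u < size s"
proof (cases s)
  case (Fun f ts)
  assume "u \<in># TF A s"
  then obtain t where "t \<in> set ts" "u \<in># TF_sym A f t"
    using Fun by (auto simp: mem_sum_list_mset)
  then show ?thesis
    using TF_sym_size[of u A f t] size_list_estimation'[of t ts "size t" size] Fun by auto
qed auto

text \<open>A variable may be instantiated by a term with root \<open>f\<close>, so the elements
  have to be flattened again after the substitution.\<close>

lemma TF_sym_subst:
  "TF_sym A f (subst \<sigma> s) = (\<Sum>u \<in># TF_sym A f s. TF_sym A f (subst \<sigma> u))"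
  by (induction A f s rule: TF_sym.induct) auto

lemma TF_subst:
  assumes "root s = Inr f"
  shows "TF A (subst \<sigma> s) = (\<Sum>u \<in># TF A s. TF_sym A f (subst \<sigma> u))"
proof (cases s)
  case (Fun g ts)
  have "(\<Sum>t\<leftarrow>ts. TF_sym A g (subst \<sigma> t)) =
      (\<Sum>u \<in># (\<Sum>t\<leftarrow>ts. TF_sym A g t). TF_sym A g (subst \<sigma> u))"
    by (induction ts) (auto intro: TF_sym_subst)
  then show ?thesis using Fun assms by (simp add: o_def)
qed (use assms in simp)

lemma ac_eq_subst: "ac_eq A s t \<Longrightarrow> ac_eq A (subst \<sigma> s) (subst \<sigma> t)"
proof (induction rule: ac_eq.induct)
  case (cong ss ts f)
  have "list_all2 (ac_eq A) (map (subst \<sigma>) ss) (map (subst \<sigma>) ts)"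
    using cong.IH by (auto simp: list.rel_map elim: list_all2_mono)
  then show ?case by (auto intro: ac_eq.cong)
qed (auto intro: ac_eq.intros)

lemma subst_in_terms:
  assumes "s \<in> terms F ar V" "\<forall>x \<in> V. \<sigma> x \<in> terms F ar V"
  shows "subst \<sigma> s \<in> terms F ar V"
  using assms(1) by induction (use assms(2) in \<open>auto intro!: terms.Fun\<close>)

lemma fill_in_terms:
  assumes "C \<in> ctxts F ar V" "s \<in> terms F ar V"
  shows "fill C s \<in> terms F ar V"
  using assms(1) by induction (use assms(2) in \<open>auto intro!: terms.Fun\<close>)

lemma terms_FunD:
  assumes "Fun f ts \<in> terms F ar V"
  shows "f \<in> F" "length ts = ar f" "set ts \<subseteq> terms F ar V"
  using assms by (auto elim: terms.cases)

lemma TF_sym_in_terms: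
  "u \<in># TF_sym A f s \<Longrightarrow> s \<in> terms F ar V \<Longrightarrow> u \<in> terms F ar V"
  by (induction A f s rule: TF_sym.induct) (auto split: if_splits dest: terms_FunD)

lemma TF_in_terms:
  assumes "u \<in># TF A s" "s \<in> terms F ar V"
  shows "u \<in> terms F ar V"
  using assms by (cases s) (auto simp: mem_sum_list_mset dest!: terms_FunD(3) intro: TF_sym_in_terms)

text \<open>Flattening leaves a term with AC root \<open>f\<close> in place only if its number of
  arguments is not two, which the arity excludes.\<close>

lemma TF_sym_root:
  "u \<in># TF_sym A f s \<Longrightarrow> s \<in> terms F ar V \<Longrightarrow> f \<in> A \<Longrightarrow> ar f = 2 \<Longrightarrow> root u \<noteq> Inr f"
  by (induction A f s rule: TF_sym.induct) (auto split: if_splits dest: terms_FunD)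

section \<open>Properties of the order\<close>

text \<open>This rule and the case rule \<open>acmpo_cases\<close> exchange the third clause for
  \<open>ms_ext\<close> with the kernel map \<open>ac_rep A\<close>.\<close>

lemma acmpo_mulI:
  assumes "root s = Inr f" "root t = Inr f" "ms_ext (ac_rep A) (acmpo A prec) (TF A s) (TF A t)"
  shows "acmpo A prec s t"
  using assms by (auto elim!: ms_extE simp flip: rel_mset'_ac_eq_iff intro: acmpo.mul)

lemma acmpo_cases [consumes 1, case_names sub prec mul]:
  assumes "acmpo A prec s t"
  obtains f s' where "root s = Inr f" "s' \<in># TF A s" "acmpo A prec s' t \<or> ac_eq A s' t"
  | f g where "root s = Inr f" "root t = Inr g" "prec f g" "\<And>t'. t' \<in># TF A t \<Longrightarrow> acmpo A prec s t'"
  | f where "root s = Inr f" "root t = Inr f" "ms_ext (ac_rep A) (acmpo A prec) (TF A s) (TF A t)"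
  using assms
proof cases
  case (mul f S1 S2 T1 T2)
  then have "ms_ext (ac_rep A) (acmpo A prec) (TF A s) (TF A t)"
    by (intro ms_extI[of _ S1 S2 _ T1 T2]) (simp_all add: rel_mset'_ac_eq_iff)
  then show ?thesis using mul that(3) by blast
qed (use that in blast)+

lemma acmpo_root: "acmpo A prec s t \<Longrightarrow> \<exists>f. root s = Inr f"
  by (auto elim: acmpo.cases)

section \<open>Compatibility with AC equality\<close>

text \<open>AC-equal terms have the same root and, up to representatives, the same top-flattening,
  so each clause transfers from one pair to the other.\<close>

lemma acmpo_ac_compatible:
  "acmpo A prec s t \<Longrightarrow> ac_eq A s s' \<Longrightarrow> ac_eq A t t' \<Longrightarrow> acmpo A prec s' t'"
proof (induction arbitrary: s' t' rule: acmpo.induct)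
  case (sub s f u t)
  have "root s' = Inr f" using sub ac_eq_root by metis
  moreover obtain u' where u': "u' \<in># TF A s'" "ac_eq A u u'"
    using image_mset_eq_memD[OF ac_eq_TF[OF ac_eq.sym[OF sub.prems(1)]] sub.hyps(2)]
    by (metis ac_eq_iff_rep)
  moreover have "acmpo A prec u' t' \<or> ac_eq A u' t'"
    using sub.IH sub.prems(2) u'(2) by (meson ac_eq.sym ac_eq.trans)
  ultimately show ?case by (intro acmpo.sub)
next
  case (prec s f t g)
  have "root s' = Inr f" "root t' = Inr g" using prec ac_eq_root by metis+
  moreover have "\<forall>u \<in># TF A t'. acmpo A prec s' u"
  proof
    fix u assume "u \<in># TF A t'"
    then obtain v where "v \<in># TF A t" "ac_eq A v u"
      using image_mset_eq_memD[OF ac_eq_TF[OF prec.prems(2)]] by (metis ac_eq_iff_rep)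
    then show "acmpo A prec s' u" using prec.IH prec.prems(1) by blast
  qed
  ultimately show ?case using prec.hyps(3) by (intro acmpo.prec)
next
  case (mul s f t S1 S2 T1 T2)
  let ?r = "image_mset (ac_rep A)"
  have "root s' = Inr f" "root t' = Inr f" using mul ac_eq_root by metis+
  moreover have "?r (TF A s') = ?r S1 + ?r S2"
    using ac_eq_TF[OF mul.prems(1)] mul.hyps(3) by simp
  then obtain S1' S2' where S: "TF A s' = S1' + S2'" "?r S1' = ?r S1" "?r S2' = ?r S2"
    by (metis image_mset_eq_plusD)
  moreover have "?r (TF A t') = ?r T1 + ?r T2"
    using ac_eq_TF[OF mul.prems(2)] mul.hyps(4) by simp
  then obtain T1' T2' where T: "TF A t' = T1' + T2'" "?r T1' = ?r T1" "?r T2' = ?r T2"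
    by (metis image_mset_eq_plusD)
  moreover have "\<forall>u \<in># T2'. \<exists>v \<in># S2'. acmpo A prec v u"
  proof
    fix u assume "u \<in># T2'"
    then obtain t1 where t1: "t1 \<in># T2" "ac_eq A t1 u"
      using image_mset_eq_memD[OF T(3)[symmetric]] by (metis ac_eq_iff_rep)
    then obtain s1 where s1: "s1 \<in># S2"
      and IH: "\<And>v u. ac_eq A s1 v \<Longrightarrow> ac_eq A t1 u \<Longrightarrow> acmpo A prec v u"
      using mul.IH by blast
    obtain v where "v \<in># S2'" "ac_eq A s1 v"
      using image_mset_eq_memD[OF S(3) s1] by (metis ac_eq_iff_rep)
    then show "\<exists>v \<in># S2'. acmpo A prec v u" using IH t1 by blast
  qed
  ultimately show ?case
    using mul.hyps(5,6) by (intro acmpo.mul[of _ f _ _ S1' S2' T1' T2'])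
      (auto simp: rel_mset'_ac_eq_iff)
qed

lemma acmpo_TF: "root s = Inr f \<Longrightarrow> u \<in># TF A s \<Longrightarrow> acmpo A prec s u"
  by (auto intro: acmpo.sub ac_eq.refl)

section \<open>Signatures with minimal AC symbols\<close>

locale ac_precedence =
  fixes F A :: "'f set" and ar :: "'f \<Rightarrow> nat" and V :: "'v set" and prec :: "'f \<Rightarrow> 'f \<Rightarrow> bool"
  assumes AC_sub: "A \<subseteq> F"
    and AC_binary: "f \<in> A \<Longrightarrow> ar f = 2"
    and wf_prec: "wf_precedence F prec"
    and AC_minimal: "f \<in> A \<Longrightarrow> g \<in> F \<Longrightarrow> \<not> prec f g"
begin

abbreviation T :: "('f, 'v) trm set" where "T \<equiv> terms F ar V"
abbreviation gt :: "('f, 'v) trm \<Rightarrow> ('f, 'v) trm \<Rightarrow> bool" (infix "\<succ>" 50) where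
  "s \<succ> t \<equiv> acmpo A prec s t"
abbreviation eqv :: "('f, 'v) trm \<Rightarrow> ('f, 'v) trm \<Rightarrow> bool" (infix "\<approx>" 50) where
  "s \<approx> t \<equiv> ac_eq A s t"

lemma root_in_F: "s \<in> T \<Longrightarrow> root s = Inr f \<Longrightarrow> f \<in> F"
  by (cases s) (auto dest: terms_FunD)

lemma TF_sym_terms:
  assumes "s \<in> T"
  shows "TF_sym A f s = (if f \<in> A \<and> root s = Inr f then TF A s else {#s#})"
  using assms AC_binary by (cases s) (auto simp: TF_sym_Fun dest: terms_FunD)

section \<open>Transitivity\<close>

text \<open>The sum of the three sizes decreases whenever a term is replaced by an element of its
  top-flattening; the clauses behind \<open>s \<succ> t\<close> and \<open>t \<succ> u\<close> are
  combined pairwise.\<close>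

lemma acmpo_trans:
  assumes "s \<in> T" "t \<in> T" "u \<in> T" "s \<succ> t" "t \<succ> u"
  shows "s \<succ> u"
  using assms
proof (induction "size s + size t + size u" arbitrary: s t u rule: less_induct)
  case less
  note in_T = less.prems(1-3)
  have IH: "s' \<succ> u'" if "s' \<succ> t'" "t' \<succ> u'" "s' \<in> T" "t' \<in> T" "u' \<in> T"
    "size s' + size t' + size u' < size s + size t + size u" for s' t' u'
    using less.hyps[OF that(6)] that by blast
  have le: "s' \<succ> u'" if "s' \<succ> t'" "t' \<succ> u' \<or> t' \<approx> u'" "s' \<in> T" "t' \<in> T" "u' \<in> T"
    "size s' + size t' + size u' < size s + size t + size u" for s' t' u'
    using that IH acmpo_ac_compatible ac_eq.refl by metis
  from \<open>s \<succ> t\<close> obtain f where f: "root s = Inr f" using acmpo_root by blast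
  from \<open>t \<succ> u\<close> obtain g where g: "root t = Inr g" using acmpo_root by blast
  have F: "f \<in> F" "g \<in> F" using f g in_T root_in_F by auto
  have TF_u: "s \<succ> u'" if "u' \<in># TF A u" "t \<succ> u'" for u'
    using IH[OF \<open>s \<succ> t\<close> that(2)] in_T TF_in_terms[OF that(1)] TF_size[OF that(1)] by auto
  \<comment> \<open>Each element of \<open>TF A u\<close> is matched or dominated by one of
    \<open>TF A t\<close>, so clause \<open>acmpo.sub\<close> applies to \<open>t\<close>.\<close>
  have mul_TF: "t \<succ> u'" if "ms_ext (ac_rep A) (\<succ>) (TF A t) (TF A u)" "u' \<in># TF A u" for u'
  proof -
    have "\<exists>t' \<in># TF A t. t' \<succ> u' \<or> t' \<approx> u'"
      using that by (elim ms_extE) (auto simp: ac_eq_iff_rep elim: image_mset_eq_memD)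
    then show ?thesis using g by (auto intro: acmpo.sub)
  qed
  show ?case using \<open>s \<succ> t\<close>
  proof (cases rule: acmpo_cases)
    case (sub f' s')
    have "s' \<succ> u"
      using sub(3)
    proof
      assume "s' \<succ> t"
      then show ?thesis
        using IH[of s' t u] \<open>t \<succ> u\<close> in_T TF_in_terms[OF sub(2)] TF_size[OF sub(2)] by auto
    next
      assume "s' \<approx> t"
      then show ?thesis
        using acmpo_ac_compatible[OF \<open>t \<succ> u\<close>] by (blast intro: ac_eq.sym ac_eq.refl)
    qed
    then show ?thesis using sub by (blast intro: acmpo.sub)
  next
    case (prec f' g')
    then have fg: "prec f g" using f g by simp
    from \<open>t \<succ> u\<close> show ?thesis
    proof (cases rule: acmpo_cases)
      case (sub h t')
      then show ?thesis
        using le[OF prec(4)[OF sub(2)] sub(3)] in_T TF_in_terms[OF sub(2)] TF_size[OF sub(2)] by auto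
    next
      case p: (prec g'' h)
      then have "prec f h"
        using fg g F root_in_F[OF in_T(3)] wf_prec transp_onD[of F prec f g h]
        by (simp add: wf_precedence_def)
      then show ?thesis using f p TF_u by (intro acmpo.prec) auto
    next
      case (mul h)
      then show ?thesis using f g fg TF_u mul_TF by (intro acmpo.prec) auto
    qed
  next
    case mul1: (mul f')
    from \<open>t \<succ> u\<close> show ?thesis
    proof (cases rule: acmpo_cases)
      case (sub h t')
      from mul1(3) have "\<exists>s' \<in># TF A s. s' \<succ> t' \<or> s' \<approx> t'"
        using sub(2) by (elim ms_extE) (auto simp: ac_eq_iff_rep elim: image_mset_eq_memD)
      then obtain s' where s': "s' \<in># TF A s" "s' \<succ> t' \<or> s' \<approx> t'" by blast
      have "s' \<succ> u \<or> s' \<approx> u"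
        using s'(2)
      proof
        assume "s' \<succ> t'"
        then show ?thesis
          using le[of s' t' u] sub in_T TF_in_terms[OF sub(2)] TF_size[OF sub(2)]
            TF_in_terms[OF s'(1)] TF_size[OF s'(1)] by auto
      next
        assume "s' \<approx> t'"
        then show ?thesis
          using sub(3) by (meson acmpo_ac_compatible ac_eq.sym ac_eq.refl ac_eq.trans)
      qed
      then show ?thesis using s' f by (blast intro: acmpo.sub)
    next
      case p: (prec g'' h)
      then show ?thesis using f mul1 TF_u[OF _ acmpo_TF]
        by (intro acmpo.prec[of _ f _ h]) (auto intro: TF_u)
    next
      case mul2: (mul h)
      have "ms_ext (ac_rep A) (\<succ>) (TF A s) (TF A u)"
      proof (rule ms_ext_trans[OF mul1(3) mul2(3)])
        fix s' t' u' assume *: "s' \<in># TF A s" "t' \<in># TF A t" "u' \<in># TF A u" "s' \<succ> t'" "t' \<succ> u'"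
        then show "s' \<succ> u'"
          using IH[of s' t' u'] in_T TF_in_terms TF_size[OF *(1)] TF_size[OF *(2)] TF_size[OF *(3)]
          by force
      qed (metis acmpo_ac_compatible ac_eq_iff_rep)+
      then show ?thesis using mul1 mul2 by (intro acmpo_mulI[of _ f']) auto
    qed
  qed
qed

lemma acmpo_TF_right:
  assumes "s \<succ> t" "s \<in> T" "t \<in> T" "u \<in># TF A t"
  shows "s \<succ> u"
proof (cases t)
  case (Fun g ts)
  then show ?thesis
    using acmpo_trans[OF assms(2,3) TF_in_terms[OF assms(4,3)] assms(1) acmpo_TF[of t g]] assms(4)
    by simp
qed (use assms in simp)

lemma acmpo_TF_sym_right:
  assumes "s \<succ> t" "s \<in> T" "t \<in> T" "u \<in># TF_sym A f t"
  shows "s \<succ> u"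
  using assms acmpo_TF_right by (auto simp: TF_sym_terms split: if_splits)

section \<open>Closure under contexts\<close>

lemma TF_root:
  assumes "s \<in> T" "root s = Inr f" "f \<in> A" "u \<in># TF A s"
  shows "root u \<noteq> Inr f"
  using assms TF_sym_terms[of s f] AC_binary by (intro TF_sym_root[of u A f s F ar V]) auto

text \<open>Strictness rests on this bound: removing one element from the top-flattening of an
  AC-rooted term leaves a nonempty rest.\<close>

lemma size_TF_AC:
  assumes "s \<in> T" "root s = Inr f" "f \<in> A"
  shows "size (TF A s) \<ge> 2"
proof -
  from assms obtain ts where s: "s = Fun f ts" and "length ts = 2"
    using AC_binary by (cases s) (auto dest: terms_FunD)
  then obtain a b where "ts = [a, b]" by (auto simp: length_Suc_conv numeral_2_eq_2)
  moreover have "size (TF_sym A f a) \<ge> 1" "size (TF_sym A f b) \<ge> 1"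
    using TF_sym_neq_empty[of A f] by (metis One_nat_def Suc_leI nonempty_has_size)+
  ultimately show ?thesis using s by simp
qed

text \<open>This is the effect of placing \<open>s\<close> and \<open>t\<close> directly below
  \<open>f\<close>. If \<open>s\<close> is not flattened, it alone dominates all of
  \<open>TF_sym A f t\<close>; otherwise minimality of \<open>f\<close> leaves only the first and
  third clauses.\<close>

lemma ms_ext_TF_sym:
  assumes gt: "s \<succ> t" and in_T: "s \<in> T" "t \<in> T"
  shows "ms_ext (ac_rep A) (\<succ>) (TF_sym A f s) (TF_sym A f t)"
proof (cases "f \<in> A \<and> root s = Inr f")
  case False
  then have s: "TF_sym A f s = {#s#}" using in_T by (auto simp: TF_sym_terms)
  show ?thesis
    unfolding s
    by (rule ms_extI[of _ "{#}" "{#s#}" _ "{#}"]) (use acmpo_TF_sym_right[OF gt in_T] in auto)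
next
  case True
  then have f: "f \<in> A" "root s = Inr f" by auto
  then have s: "TF_sym A f s = TF A s" using in_T by (simp add: TF_sym_terms)
  from gt show ?thesis
  proof (cases rule: acmpo_cases)
    case (sub f' s')
    then obtain M where M: "TF A s = {#s'#} + M" by (metis insert_DiffM add_mset_add_single union_commute)
    from sub(3) show ?thesis
    proof
      assume "s' \<succ> t"
      moreover have "s' \<in> T" using TF_in_terms sub(2) in_T by blast
      ultimately show ?thesis
        unfolding s using M acmpo_TF_sym_right in_T
        by (intro ms_extI[of _ "{#}" "TF A s" _ "{#}"]) auto
    next
      assume eq: "s' \<approx> t"
      \<comment> \<open>Elements of the flattened \<open>s\<close> do not have root
        \<open>f\<close>, hence neither does \<open>t\<close>, which therefore is a single element
        matched with \<open>s'\<close>. The rest \<open>M\<close> gives strictness.\<close>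
      then have "root t \<noteq> Inr f" using TF_root[OF in_T(1) f(2,1) sub(2)] ac_eq_root by metis
      then have t: "TF_sym A f t = {#t#}" using in_T by (simp add: TF_sym_terms)
      have "M \<noteq> {#}" using size_TF_AC[OF in_T(1) f(2,1)] M by auto
      then show ?thesis
        unfolding s t using M eq by (intro ms_extI[of _ "{#s'#}" M _ "{#t#}" "{#}"]) (auto simp: ac_eq_iff_rep)
    qed
  next
    case (prec f' g)
    then show ?thesis using f AC_minimal root_in_F[OF in_T(2)] by auto
  next
    case (mul f')
    then show ?thesis using f in_T by (simp add: TF_sym_terms)
  qed
qed

text \<open>Each layer makes the roots equal and adds the same elements to both sides, so the third
  clause applies whether or not the symbol is AC.\<close>

lemma acmpo_fill:
  assumes "C \<in> ctxts F ar V" "s \<succ> t" "s \<in> T" "t \<in> T"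
  shows "fill C s \<succ> fill C t"
  using assms(1)
proof induction
  case (More f us vs C)
  let ?u = "fill C s" and ?v = "fill C t"
  have "ms_ext (ac_rep A) (\<succ>) (TF_sym A f ?u) (TF_sym A f ?v)"
    using More assms by (intro ms_ext_TF_sym fill_in_terms) auto
  from ms_ext_plus[OF this, of "(\<Sum>t\<leftarrow>us. TF_sym A f t) + (\<Sum>t\<leftarrow>vs. TF_sym A f t)"]
  have "ms_ext (ac_rep A) (\<succ>) (TF A (Fun f (us @ ?u # vs))) (TF A (Fun f (us @ ?v # vs)))"
    by (simp add: ac_simps)
  then show ?case by (auto intro: acmpo_mulI)
qed (use assms in simp)

section \<open>Closure under substitutions\<close>

text \<open>The difficulty is that \<sigma> may put the AC root of \<open>s\<close> at a variable in
  \<open>TF A s\<close>, so that its instance is flattened as well. Elements that dominate others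
  are not variables and keep their root.\<close>

lemma acmpo_subst:
  assumes \<sigma>: "\<forall>x \<in> V. \<sigma> x \<in> T"
  shows "s \<succ> t \<Longrightarrow> s \<in> T \<Longrightarrow> t \<in> T \<Longrightarrow> subst \<sigma> s \<succ> subst \<sigma> t"
proof (induction rule: acmpo.induct)
  case (sub s f s' t)
  have root: "root (subst \<sigma> s) = Inr f" using sub.hyps by (cases s) auto
  have s': "s' \<in> T" using sub TF_in_terms by blast
  have in_T: "subst \<sigma> s \<in> T" "subst \<sigma> s' \<in> T" "subst \<sigma> t \<in> T"
    using sub s' subst_in_terms \<sigma> by blast+
  have ge: "subst \<sigma> s' \<succ> subst \<sigma> t \<or> subst \<sigma> s' \<approx> subst \<sigma> t"
    using sub.IH sub.prems s' ac_eq_subst by blast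
  obtain M where M: "TF A s = add_mset s' M" using sub.hyps(2) by (metis insert_DiffM)
  have TF: "TF A (subst \<sigma> s) = TF_sym A f (subst \<sigma> s') + (\<Sum>u \<in># M. TF_sym A f (subst \<sigma> u))"
    using M by (simp add: TF_subst[OF sub.hyps(1)])
  show ?case
  proof (cases "f \<in> A \<and> root (subst \<sigma> s') = Inr f")
    case False
    then have "subst \<sigma> s' \<in># TF A (subst \<sigma> s)"
      using TF in_T by (auto simp: TF_sym_terms)
    then show ?thesis using ge root by (blast intro: acmpo.sub)
  next
    case True
    \<comment> \<open>Here \<open>s'\<close> is a variable, and the flattened \<open>subst \<sigma> s'\<close> is a proper part of \<open>subst \<sigma> s\<close>.\<close>
    have "M \<noteq> {#}" using size_TF_AC[OF sub.prems(1) sub.hyps(1)] True M by auto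
    then obtain v N where "M = add_mset v N" by (meson multiset_cases)
    then have ne: "(\<Sum>u \<in># M. TF_sym A f (subst \<sigma> u)) \<noteq> {#}"
      using TF_sym_neq_empty[of A f "subst \<sigma> v"] by simp
    have "ms_ext (ac_rep A) (\<succ>) (TF A (subst \<sigma> s)) (TF A (subst \<sigma> s'))"
      by (rule ms_extI[of _ "TF_sym A f (subst \<sigma> s')" "\<Sum>u \<in># M. TF_sym A f (subst \<sigma> u)"
            _ "TF A (subst \<sigma> s')" "{#}"])
        (use True ne in_T TF in \<open>auto simp: TF_sym_terms\<close>)
    then have "subst \<sigma> s \<succ> subst \<sigma> s'" using True root by (intro acmpo_mulI) auto
    then show ?thesis
      using ge acmpo_trans[OF in_T] acmpo_ac_compatible ac_eq.refl by metis
  qed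
next
  case (prec s f t g)
  have root: "root (subst \<sigma> s) = Inr f" "root (subst \<sigma> t) = Inr g"
    using prec.hyps by (cases s; cases t; simp)+
  have "subst \<sigma> s \<succ> u" if u: "u \<in># TF A (subst \<sigma> t)" for u
  proof -
    obtain t' where t': "t' \<in># TF A t" "u \<in># TF_sym A g (subst \<sigma> t')"
      using u by (auto simp: TF_subst[OF prec.hyps(2)])
    have "t' \<in> T" using TF_in_terms t' prec by blast
    then show ?thesis
      using prec t' \<sigma> by (intro acmpo_TF_sym_right[OF _ _ _ t'(2)] subst_in_terms) auto
  qed
  then show ?case using root prec.hyps by (intro acmpo.prec) auto
next
  case (mul s f t S1 S2 T1 T2)
  have root: "root (subst \<sigma> s) = Inr f" "root (subst \<sigma> t) = Inr f"
    using mul.hyps by (cases s; cases t; simp)+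
  \<comment> \<open>This is the contribution of a part of the top-flattening to that of the
    instance; by \<open>TF_subst\<close> the given splittings pass through \<open>h\<close>.\<close>
  define h where "h M = (\<Sum>u \<in># M. TF_sym A f (subst \<sigma> u))" for M
  have h_plus: "h (M + N) = h M + h N" for M N by (simp add: h_def)
  have sT: "u \<in> T" if "u \<in># S1 + S2" for u
    using that TF_in_terms[of u A s] mul by simp
  have tT: "u \<in> T" if "u \<in># T1 + T2" for u
    using that TF_in_terms[of u A t] mul by simp
  have "rel_mset' eqv S1 T1 \<Longrightarrow> image_mset (ac_rep A) (h S1) = image_mset (ac_rep A) (h T1)"
    by (induction "ac_eq A :: ('f, 'v) trm \<Rightarrow> _" S1 T1 rule: rel_mset'.induct)
      (auto simp: h_def ac_eq_TF_sym ac_eq_subst)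
  moreover obtain v N where "S2 = add_mset v N" using mul.hyps by (meson multiset_cases)
  then have "h S2 \<noteq> {#}" using TF_sym_neq_empty[of A f "subst \<sigma> v"] by (simp add: h_def)
  moreover have "\<exists>v \<in># h S2. v \<succ> u" if "u \<in># h T2" for u
  proof -
    obtain t' where t': "t' \<in># T2" "u \<in># TF_sym A f (subst \<sigma> t')"
      using \<open>u \<in># h T2\<close> by (auto simp: h_def)
    then obtain s' where s': "s' \<in># S2" "s' \<succ> t'" "subst \<sigma> s' \<succ> subst \<sigma> t'"
      using mul.IH sT tT by (metis union_iff)
    have in_T: "subst \<sigma> s' \<in> T" "subst \<sigma> t' \<in> T"
      using s'(1) t'(1) sT tT \<sigma> by (auto intro!: subst_in_terms)
    \<comment> \<open>A dominating element is not a variable, so its root \<open>g\<close> survives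
      the substitution. It differs from \<open>f\<close> if \<open>f\<close> is AC, so the instance
      stays a single element of \<open>h S2\<close>.\<close>
    obtain g where g: "root s' = Inr g" using s'(2) acmpo_root by blast
    then have "root (subst \<sigma> s') = Inr g" by (cases s') auto
    moreover have "g \<noteq> f" if "f \<in> A"
      using TF_root[OF mul.prems(1) mul.hyps(1) that, of s'] s'(1) g mul.hyps(3) by auto
    ultimately have "TF_sym A f (subst \<sigma> s') = {#subst \<sigma> s'#}"
      using in_T by (auto simp: TF_sym_terms)
    then have "subst \<sigma> s' \<in># h S2" using s'(1) by (force simp: h_def)
    then show ?thesis using acmpo_TF_sym_right[OF s'(3) in_T t'(2)] by blast
  qed
  ultimately have "ms_ext (ac_rep A) (\<succ>) (TF A (subst \<sigma> s)) (TF A (subst \<sigma> t))"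
    using mul.hyps(5) by (intro ms_extI[of _ "h S1" "h S2" _ "h T1" "h T2"])
      (simp_all add: TF_subst[OF mul.hyps(1)] TF_subst[OF mul.hyps(2)] mul.hyps(3,4) flip: h_def h_plus)
  then show ?case using root by (intro acmpo_mulI)
qed

section \<open>Well-foundedness\<close>

text \<open>The smaller term comes first, as \<open>accp\<close> expects. Confining both terms to
  \<open>T\<close> leaves terms outside \<open>T\<close> without predecessors, hence
  accessible.\<close>

definition less_T :: "('f, 'v) trm \<Rightarrow> ('f, 'v) trm \<Rightarrow> bool" where
  "less_T t s \<longleftrightarrow> s \<in> T \<and> t \<in> T \<and> s \<succ> t"

text \<open>AC symbols are binary and belong to \<open>F\<close>, so rearranging them keeps terms
  well-formed; in particular representatives of members of \<open>T\<close> stay in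
  \<open>T\<close>.\<close>

lemma ac_eq_in_terms: "s \<approx> t \<Longrightarrow> s \<in> T \<longleftrightarrow> t \<in> T"
proof (induction rule: ac_eq.induct)
  case (assoc f s t u)
  then show ?case using AC_sub AC_binary
    by (auto dest!: terms_FunD intro!: terms.Fun)
next
  case (comm f s t)
  then show ?case using AC_sub AC_binary
    by (auto dest!: terms_FunD intro!: terms.Fun)
next
  case (cong ss ts f)
  have "set ss \<subseteq> T \<longleftrightarrow> set ts \<subseteq> T" "length ss = length ts"
    using cong.IH by (induction rule: list_all2_induct) auto
  moreover have "Fun f us \<in> T \<longleftrightarrow> f \<in> F \<and> length us = ar f \<and> set us \<subseteq> T" for us
    by (auto dest: terms_FunD intro: terms.Fun)
  ultimately show ?case by simp
qed auto

lemma less_T_rep: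
  assumes "less_T t s"
  shows "less_T (ac_rep A t) (ac_rep A s)"
  using assms ac_eq_rep[of A] ac_eq_in_terms acmpo_ac_compatible unfolding less_T_def by blast

text \<open>By AC-compatibility every predecessor of the representative is one of
  \<open>s\<close>.\<close>

lemma accp_less_T_rep:
  assumes "Wellfounded.accp less_T s"
  shows "Wellfounded.accp less_T (ac_rep A s)"
proof (rule accp.intros)
  fix u assume "less_T u (ac_rep A s)"
  then have "less_T u s"
    using ac_eq_rep[of A s] ac_eq_in_terms acmpo_ac_compatible ac_eq.sym ac_eq.refl
    unfolding less_T_def by metis
  then show "Wellfounded.accp less_T u" using assms by (rule accp_downward[rotated])
qed

text \<open>Each clause for \<open>s \<succ> t\<close> has its own source of accessibility: the
  first an element of \<open>TF A s\<close>, the second the induction on the precedence, the third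
  the induction on the multiset.\<close>

lemma accp_less_T_Fun:
  assumes "s \<in> T" "root s = Inr f" "\<And>u. u \<in># TF A s \<Longrightarrow> Wellfounded.accp less_T u"
  shows "Wellfounded.accp less_T s"
proof -
  \<comment> \<open>Upper terms are required to be accessible, which makes \<open>Q\<close>
    well-founded before \<open>less_T\<close> is known to be.\<close>
  define Q where "Q = {(t, s). less_T t s \<and> Wellfounded.accp less_T s}"
  have "wf Q"
  proof (rule wfUNIVI)
    fix P x assume step: "\<forall>x. (\<forall>y. (y, x) \<in> Q \<longrightarrow> P y) \<longrightarrow> P x"
    have acc: "P y" if "Wellfounded.accp less_T y" for y
      using that
    proof (rule accp_induct)
      fix z assume "Wellfounded.accp less_T z" "\<forall>w. less_T w z \<longrightarrow> P w"
      then have "\<forall>y. (y, z) \<in> Q \<longrightarrow> P y" by (simp add: Q_def)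
      with step show "P z" by simp
    qed
    \<comment> \<open>If \<open>x\<close> is not accessible, it has no predecessors in
      \<open>Q\<close>; otherwise its predecessors are accessible.\<close>
    have "\<forall>y. (y, x) \<in> Q \<longrightarrow> P y"
      using acc accp_downward[of less_T] by (auto simp: Q_def)
    with step show "P x" by blast
  qed
  then have wfQ: "wf (mult Q)" by (rule wf_mult)
  have wfF: "wfp_on F prec\<inverse>\<inverse>" using wf_prec by (simp add: wf_precedence_def)
  have f: "f \<in> F" using assms root_in_F by blast
  from wfF show ?thesis using assms
  proof (induction f arbitrary: s rule: wfp_on_induct)
    case in_set
    show ?case by (rule f)
  next
    case (less f s)
    note IH_prec = less.IH
    \<comment> \<open>Matched parts agree only up to AC; mapping to representatives makes them
      equal, as \<open>mult\<close> requires.\<close>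
    from wfQ less.prems show ?case
    proof (induction "image_mset (ac_rep A) (TF A s)" arbitrary: s rule: wf_induct_rule)
      case (less s)
      have "less_T t s \<Longrightarrow> Wellfounded.accp less_T t" for t
      proof (induction "size t" arbitrary: t rule: less_induct)
        case inner: (less t)
        have t: "t \<in> T" "s \<succ> t" using inner.prems by (auto simp: less_T_def)
        \<comment> \<open>These elements lie below \<open>s\<close> and are smaller in size than
          \<open>t\<close>, so the innermost hypothesis applies. Both outer hypotheses need their
          accessibility to yield that of \<open>t\<close>.\<close>
        have acc_TF: "Wellfounded.accp less_T u" if "u \<in># TF A t" for u
          using that inner.hyps[of u] TF_size[OF that] TF_in_terms[OF that t(1)]
            acmpo_TF_right[OF t(2) _ t(1) that] less.prems by (auto simp: less_T_def)
        from t(2) show ?case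
        proof (cases rule: acmpo_cases)
          case (sub f' s')
          have "s' \<in> T" using TF_in_terms[OF sub(2)] less.prems by blast
          have "Wellfounded.accp less_T s'" using less.prems sub by blast
          from sub(3) show ?thesis
          proof
            assume "s' \<succ> t"
            then show ?thesis
              using \<open>Wellfounded.accp less_T s'\<close> \<open>s' \<in> T\<close> t by (auto simp: less_T_def elim: accp_downward)
          next
            assume eq: "s' \<approx> t"
            show ?thesis
            proof (rule accp.intros)
              fix u assume "less_T u t"
              then have "less_T u s'"
                using eq \<open>s' \<in> T\<close> acmpo_ac_compatible ac_eq.sym ac_eq.refl
                unfolding less_T_def by metis
              then show "Wellfounded.accp less_T u"
                using \<open>Wellfounded.accp less_T s'\<close> by (rule accp_downward[rotated])
            qed
          qed
        next
          case (prec f' g)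
          then show ?thesis
            using IH_prec[of g t] root_in_F[OF t(1)] less.prems acc_TF t by auto
        next
          case (mul f')
          let ?r = "image_mset (ac_rep A)"
          obtain S1 S2 T1 T2 where *: "TF A s = S1 + S2" "TF A t = T1 + T2" "?r S1 = ?r T1"
            "S2 \<noteq> {#}" "\<And>t. t \<in># T2 \<Longrightarrow> \<exists>s \<in># S2. s \<succ> t"
            using mul(3) by (rule ms_extE) (blast intro: that)
          have "\<exists>j \<in> set_mset (?r S2). (k, j) \<in> Q" if k: "k \<in># ?r T2" for k
          proof -
            obtain t' where t': "t' \<in># T2" "k = ac_rep A t'" using k by auto
            then obtain s' where s': "s' \<in># S2" "s' \<succ> t'" using * by blast
            have "less_T t' s'"
              using s' t' * TF_in_terms[of s' A s] TF_in_terms[of t' A t] t less.prems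
              by (auto simp: less_T_def)
            moreover have "Wellfounded.accp less_T s'" using less.prems s' * by simp
            ultimately have "(k, ac_rep A s') \<in> Q"
              using t' less_T_rep accp_less_T_rep by (auto simp: Q_def)
            then show ?thesis using s' by auto
          qed
          \<comment> \<open>The common summand is the shared image of \<open>S1\<close> and
            \<open>T1\<close>.\<close>
          then have "(?r T1 + ?r T2, ?r T1 + ?r S2) \<in> mult Q"
            using * by (intro one_step_implies_mult) auto
          then have "(?r (TF A t), ?r (TF A s)) \<in> mult Q" using * by simp
          then show ?thesis
            using less.hyps[of t] mul less.prems acc_TF t by auto
        qed
      qed
      then show ?case by (rule accp.intros)
    qed
  qed
qed

text \<open>Elements of the top-flattening are smaller in size, hence accessible by induction;
  variables and terms outside \<open>T\<close> have no predecessors.\<close>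

lemma accp_less_T: "Wellfounded.accp less_T s"
proof (induction "size s" arbitrary: s rule: less_induct)
  case less
  show ?case
  proof (cases "\<exists>f. s \<in> T \<and> root s = Inr f")
    case True
    then show ?thesis using accp_less_T_Fun less TF_size by blast
  next
    case False
    then have "\<not> less_T t s" for t by (auto simp: less_T_def dest: acmpo_root)
    then show ?thesis by (blast intro: accp.intros)
  qed
qed

lemma wfp_less_T: "wfp less_T"
  using accp_less_T by (intro accp_wfpI) blast

lemma wfp_on_acmpo: "wfp_on T (\<succ>)\<inverse>\<inverse>"
proof -
  have "wfp_on T less_T" using wfp_less_T wfp_on_subset by blast
  then show ?thesis
    by (rule wfp_on_mono_strong) (auto simp: less_T_def)
qed

lemma irreflp_on_acmpo: "irreflp_on T (\<succ>)"
  using wfp_imp_irreflp[OF wfp_less_T] by (auto simp: irreflp_on_def less_T_def)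

lemma reduction_order_acmpo: "reduction_order F ar V (\<succ>)"
  unfolding reduction_order_def
  using irreflp_on_acmpo wfp_on_acmpo acmpo_fill acmpo_subst
  by (auto intro!: transp_onI intro: acmpo_trans)

end

theorem theorem5p5:
  fixes F FAC :: "'f set" and ar :: "'f \<Rightarrow> nat" and V :: "'v set"
    and prec :: "'f \<Rightarrow> 'f \<Rightarrow> bool"
  assumes "countable V" and "infinite V"
    and "FAC \<subseteq> F" and "\<And>f. f \<in> FAC \<Longrightarrow> ar f = 2"
    and "finite FAC"
    and "wf_precedence F prec"
    and "\<And>f. f \<in> FAC \<Longrightarrow> \<not> (\<exists>g \<in> F. prec f g)"
  shows "reduction_order F ar V (acmpo FAC prec) \<and> ac_compatible F ar V FAC (acmpo FAC prec)"
proof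
  interpret ac_precedence F FAC ar V prec
    using assms by unfold_locales auto
  show "reduction_order F ar V (acmpo FAC prec)" by (rule reduction_order_acmpo)
  show "ac_compatible F ar V FAC (acmpo FAC prec)"
    unfolding ac_compatible_def by (meson acmpo_ac_compatible ac_eq.sym)
qed

end
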